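(* Let $f:\mathbb{R}\to\mathbb{C}$ be differentiable with $f$ and $f'$ continuous on $\mathbb{R}$, and suppose that $f$ is of exponential order $a$. Then for every $s=x+iy$ with $\operatorname{Re}s=x>a$ and $y\in\mathbb{R}$, $$\mathcal{SL}(f')(s)=s\,\mathcal{L}(f(t))(s)-\overline{s}\,\mathcal{L}(f(-t))(\overline{s}).$$
   Context: A function $f:\mathbb{R}\to\mathbb{C}$ is of exponential order $a$ (where $a>0$) if there is a constant $M>0$ such that $|f(t)|\le Me^{a|t|}$ for all $t\in\mathbb{R}$. The Laplace transform of a function $h$ on $[0,\infty)$ is $\mathcal{L}(h(t))(s)=\int_0^\infty e^{-st}h(t)\,dt$; thus $\mathcal{L}(f(-t))(\overline{s})=\int_0^\infty e^{-\overline{s}t}f(-t)\,dt$. For $s=x+iy$, the symmetric Laplace transform of $h:\mathbb{R}\to\mathbb{C}$ (with equal parameters $x_1=x_2=x$) is $$\mathcal{SL}(h)(s)=\int_0^\infty h(t)e^{-st}\,dt+\int_{-\infty}^0 h(t)e^{\overline{s}t}\,dt=\mathcal{L}(h(t))(s)+\mathcal{L}(h(-t))(\overline{s}).$$ Integrals over unbounded intervals are improper integrals, i.e. $\int_0^\infty=\lim_{R\to\infty}\int_0^R$ and $\int_{-\infty}^0=\lim_{R\to\infty}\int_{-R}^0$. *)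

theory Defs
  imports "HOL-Analysis.Analysis"
begin

definition exponential_order :: "real \<Rightarrow> (real \<Rightarrow> complex) \<Rightarrow> bool" where
  "exponential_order a f \<longleftrightarrow> (\<exists>M>0. \<forall>t. norm (f t) \<le> M * exp (a * \<bar>t\<bar>))"

text \<open>
  Improper integrals are limits of proper integrals over bounded intervals, so that conditionally
  convergent ones are included. Values are given by \<^const>\<open>Lim\<close>, which is unspecified
  when the limit does not exist; hence the accompanying convergence predicates.
\<close>

definition converges_0_inf :: "(real \<Rightarrow> complex) \<Rightarrow> bool" where
  "converges_0_inf g \<longleftrightarrow>
     (\<forall>R\<ge>0. g integrable_on {0..R}) \<and>
     (\<exists>I. ((\<lambda>R. integral {0..R} g) \<longlongrightarrow> I) at_top)"

definition integral_0_inf :: "(real \<Rightarrow> complex) \<Rightarrow> complex" where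
  "integral_0_inf g = Lim at_top (\<lambda>R. integral {0..R} g)"

definition converges_minf_0 :: "(real \<Rightarrow> complex) \<Rightarrow> bool" where
  "converges_minf_0 g \<longleftrightarrow>
     (\<forall>R\<ge>0. g integrable_on {-R..0}) \<and>
     (\<exists>I. ((\<lambda>R. integral {-R..0} g) \<longlongrightarrow> I) at_top)"

definition integral_minf_0 :: "(real \<Rightarrow> complex) \<Rightarrow> complex" where
  "integral_minf_0 g = Lim at_top (\<lambda>R. integral {-R..0} g)"

definition laplace_converges :: "(real \<Rightarrow> complex) \<Rightarrow> complex \<Rightarrow> bool" where
  "laplace_converges h s \<longleftrightarrow> converges_0_inf (\<lambda>t. exp (- s * of_real t) * h t)"

definition laplace :: "(real \<Rightarrow> complex) \<Rightarrow> complex \<Rightarrow> complex" where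
  "laplace h s = integral_0_inf (\<lambda>t. exp (- s * of_real t) * h t)"

definition sym_laplace_converges :: "(real \<Rightarrow> complex) \<Rightarrow> complex \<Rightarrow> bool" where
  "sym_laplace_converges h s \<longleftrightarrow>
     converges_0_inf (\<lambda>t. h t * exp (- s * of_real t)) \<and>
     converges_minf_0 (\<lambda>t. h t * exp (cnj s * of_real t))"

definition sym_laplace :: "(real \<Rightarrow> complex) \<Rightarrow> complex \<Rightarrow> complex" where
  "sym_laplace h s =
     integral_0_inf (\<lambda>t. h t * exp (- s * of_real t)) +
     integral_minf_0 (\<lambda>t. h t * exp (cnj s * of_real t))"

end

theory Submission
  imports Defs "HOL-Real_Asymp.Real_Asymp"
begin

text \<open>
  On each half-line, integration by parts turns the transform of \<open>f'\<close> into that of \<open>f\<close>; the boundary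
  term at infinity vanishes since \<open>Re s > a\<close>. The negative half-line reduces to the positive one
  by reflection, and the two boundary terms at \<open>0\<close> cancel in the sum.
\<close>

lemma Lim_at_top_eqI:
  fixes F :: "real \<Rightarrow> complex"
  assumes "(F \<longlongrightarrow> l) at_top"
  shows "Lim at_top F = l"
  using assms by (intro tendsto_Lim) auto

text \<open>For \<open>t >= 0\<close> the integrand is dominated by
  \<open>M * exp (- (Re s - a) * t)\<close>, which is integrable on the half-line because
  \<open>Re s > a\<close>. The second claim ties the value \<open>laplace h s\<close>, defined
  through \<open>Lim\<close>, to a limit that really exists.\<close>

lemma laplace_convergence:
  fixes h :: "real \<Rightarrow> complex"
  assumes cont: "continuous_on UNIV h" and "exponential_order a h" and "Re s > a"
  shows "laplace_converges h s"
    and "((\<lambda>R. integral {0..R} (\<lambda>t. exp (- s * of_real t) * h t)) \<longlongrightarrow> laplace h s) at_top"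
proof -
  let ?k = "\<lambda>t. exp (- s * of_real t) * h t"
  obtain M where M: "\<And>t. norm (h t) \<le> M * exp (a * \<bar>t\<bar>)"
    using assms(2) unfolding exponential_order_def by blast
  have ck: "continuous_on A ?k" for A
    by (intro continuous_intros continuous_on_subset[OF cont]) auto
  have "(\<lambda>t. M * exp (- (Re s - a) * t)) integrable_on {0..}"
    using integrable_on_exp_minus_to_infinity[of "Re s - a" 0] \<open>Re s > a\<close>
    by (intro integrable_on_mult_right) auto
  moreover have "norm (?k t) \<le> M * exp (- (Re s - a) * t)" if "t \<in> {0..}" for t
  proof -
    have "norm (?k t) \<le> exp (- Re s * t) * (M * exp (a * t))"
      using M[of t] that by (auto simp: norm_mult)
    also have "\<dots> = M * exp (- (Re s - a) * t)"
      by (simp add: algebra_simps flip: exp_add)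
    finally show ?thesis .
  qed
  ultimately have "?k absolutely_integrable_on {0..}"
    by (intro measurable_bounded_by_integrable_imp_absolutely_integrable
        continuous_imp_measurable_on_sets_lebesgue ck) auto
  \<comment> \<open>Absolute integrability on the whole half-line yields convergence of the
    truncated Lebesgue integrals; on each \<open>{0..R}\<close> these agree with the gauge integrals
    of the definitions.\<close>
  then have "((\<lambda>R. LINT t:{0..R}|lebesgue. ?k t) \<longlongrightarrow> (LINT t:{0..}|lebesgue. ?k t)) at_top"
    by (intro tendsto_set_lebesgue_integral_at_top) auto
  moreover have "(LINT t:{0..R}|lebesgue. ?k t) = integral {0..R} ?k" for R
    by (intro set_lebesgue_integral_eq_integral absolutely_integrable_continuous_real ck)
  ultimately have lim: "((\<lambda>R. integral {0..R} ?k) \<longlongrightarrow> (LINT t:{0..}|lebesgue. ?k t)) at_top"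
    by simp
  then show "laplace_converges h s"
    unfolding laplace_converges_def converges_0_inf_def
    using integrable_continuous_real[OF ck] by blast
  show "((\<lambda>R. integral {0..R} ?k) \<longlongrightarrow> laplace h s) at_top"
    using lim Lim_at_top_eqI[OF lim] by (simp add: laplace_def integral_0_inf_def)
qed

text \<open>No growth bound on \<open>h'\<close> is available, so convergence cannot come from
  domination: it is inherited from the right-hand side of the integration by parts. Stating a limit
  gives both convergence and value.\<close>

lemma laplace_deriv_tendsto:
  fixes h h' :: "real \<Rightarrow> complex"
  assumes deriv: "\<And>t. (h has_vector_derivative h' t) (at t)"
    and "exponential_order a h" and "Re s > a"
  shows "((\<lambda>R. integral {0..R} (\<lambda>t. h' t * exp (- s * of_real t)))
           \<longlongrightarrow> s * laplace h s - h 0) at_top"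
proof -
  let ?e = "\<lambda>t::real. exp (- s * of_real t)"
  obtain M where M: "\<And>t. norm (h t) \<le> M * exp (a * \<bar>t\<bar>)"
    using assms(2) unfolding exponential_order_def by blast
  have conth: "continuous_on UNIV h"
    using deriv by (meson continuous_at_imp_continuous_on has_vector_derivative_continuous)
  have parts: "integral {0..R} (\<lambda>t. h' t * ?e t)
      = h R * ?e R - h 0 + s * integral {0..R} (\<lambda>t. ?e t * h t)" if "R \<ge> 0" for R
  proof -
    have e: "(?e has_vector_derivative - s * ?e t) (at t within A)" for t A
      by (rule has_vector_derivative_real_field) (auto intro!: derivative_eq_intros)
    have "((\<lambda>t. h t * ?e t) has_vector_derivative (h' t * ?e t - s * (?e t * h t)))
            (at t within {0..R})" for t
      using has_vector_derivative_mult[OF has_vector_derivative_at_within[OF deriv] e]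
      by (simp add: algebra_simps)
    \<comment> \<open>The fundamental theorem for the gauge integral integrates the whole product
      derivative. Adding back the continuous part \<open>s * (?e t * h t)\<close> then gives
      integrability of \<open>h' t * ?e t\<close> together with its integral.\<close>
    then have "((\<lambda>t. h' t * ?e t - s * (?e t * h t)) has_integral h R * ?e R - h 0 * ?e 0) {0..R}"
      using that by (intro fundamental_theorem_of_calculus) auto
    moreover have "(\<lambda>t. ?e t * h t) integrable_on {0..R}"
      by (intro integrable_continuous_real continuous_intros continuous_on_subset[OF conth]) auto
    then have "((\<lambda>t. s * (?e t * h t)) has_integral s * integral {0..R} (\<lambda>t. ?e t * h t)) {0..R}"
      by (intro has_integral_mult_right) (rule integrable_integral)
    ultimately have "((\<lambda>t. h' t * ?e t) has_integral
        h R * ?e R - h 0 + s * integral {0..R} (\<lambda>t. ?e t * h t)) {0..R}"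
      by (auto dest: has_integral_add)
    then show ?thesis by (rule integral_unique)
  qed
  have "((\<lambda>R. h R * ?e R) \<longlongrightarrow> 0) at_top"
  proof (rule Lim_null_comparison)
    have "norm (h R * ?e R) \<le> M * exp (- (Re s - a) * R)" if "R \<ge> 0" for R
    proof -
      have "norm (h R * ?e R) \<le> (M * exp (a * R)) * exp (- Re s * R)"
        using M[of R] that by (auto simp: norm_mult)
      also have "\<dots> = M * exp (- (Re s - a) * R)"
        by (simp add: algebra_simps flip: exp_add)
      finally show ?thesis .
    qed
    then show "\<forall>\<^sub>F R in at_top. norm (h R * ?e R) \<le> M * exp (- (Re s - a) * R)"
      using eventually_ge_at_top[of "0::real"] by (rule eventually_mono[rotated])
    have "Re s - a > 0" using \<open>Re s > a\<close> by simp
    then show "((\<lambda>R. M * exp (- (Re s - a) * R)) \<longlongrightarrow> 0) at_top"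
      by real_asymp
  qed
  then have "((\<lambda>R. h R * ?e R - h 0 + s * integral {0..R} (\<lambda>t. ?e t * h t))
      \<longlongrightarrow> 0 - h 0 + s * laplace h s) at_top"
    by (intro tendsto_intros laplace_convergence(2)[OF conth assms(2,3)])
  then have "((\<lambda>R. h R * ?e R - h 0 + s * integral {0..R} (\<lambda>t. ?e t * h t))
      \<longlongrightarrow> s * laplace h s - h 0) at_top"
    by simp
  \<comment> \<open>\<open>parts\<close> holds only for \<open>R \<ge> 0\<close>, so the two
    functions of \<open>R\<close> agree eventually, which is enough for the limit.\<close>
  then show ?thesis
    by (rule Lim_transform_eventually)
       (rule eventually_mono[OF eventually_ge_at_top[of "0::real"]], simp only: parts)
qed

theorem theorem3:
  fixes f f' :: "real \<Rightarrow> complex" and a :: real and s :: complex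
  assumes "\<And>t. (f has_vector_derivative f' t) (at t)"
    and "continuous_on UNIV f"
    and "continuous_on UNIV f'"
    and "a > 0"
    and "exponential_order a f"
    and "Re s > a"
  shows "laplace_converges f s \<and>
    laplace_converges (\<lambda>t. f (- t)) (cnj s) \<and>
    sym_laplace_converges f' s \<and>
    sym_laplace f' s = s * laplace f s - cnj s * laplace (\<lambda>t. f (- t)) (cnj s)"
proof -
  let ?g = "\<lambda>t. f (- t)" and ?g' = "\<lambda>t. - f' (- t)"
  have g: "(?g has_vector_derivative ?g' t) (at t)" for t
  proof -
    have "(uminus has_vector_derivative (- 1 :: real)) (at t)"
      by (auto intro!: derivative_eq_intros)
    from vector_diff_chain_at[OF this assms(1)] show ?thesis
      by (simp add: o_def)
  qed
  have contg: "continuous_on UNIV ?g"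
    by (auto intro!: continuous_intros continuous_on_compose2[OF assms(2)])
  have ordg: "exponential_order a ?g"
    using assms(5) unfolding exponential_order_def by (metis abs_minus_cancel)
  have s': "Re (cnj s) > a"
    using assms(6) by simp
  have pos: "((\<lambda>R. integral {0..R} (\<lambda>t. f' t * exp (- s * of_real t)))
      \<longlongrightarrow> s * laplace f s - f 0) at_top"
    by (rule laplace_deriv_tendsto[OF assms(1,5,6)])
  \<comment> \<open>Substituting \<open>-t\<close> for \<open>t\<close> turns the kernel into the
    Laplace kernel at \<open>cnj s\<close>; the outer minus sign compensates the one in
    \<open>?g'\<close>, which comes from the chain rule.\<close>
  have "integral {-R..0} (\<lambda>t. f' t * exp (cnj s * of_real t))
      = - integral {0..R} (\<lambda>t. ?g' t * exp (- cnj s * of_real t))" for R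
    using Henstock_Kurzweil_Integration.integral_reflect_real
      [where a = 0 and b = R and f = "\<lambda>t. f' (- t) * exp (- cnj s * of_real t)"]
    by (simp del: Henstock_Kurzweil_Integration.integral_reflect_real)
  \<comment> \<open>As \<open>?g 0 = f 0\<close>, negating the limit for \<open>?g\<close> gives
    \<open>f 0\<close> the sign opposite to that in \<open>pos\<close>.\<close>
  then have neg: "((\<lambda>R. integral {-R..0} (\<lambda>t. f' t * exp (cnj s * of_real t)))
      \<longlongrightarrow> f 0 - cnj s * laplace ?g (cnj s)) at_top"
    using tendsto_minus[OF laplace_deriv_tendsto[OF g ordg s']] by simp
  \<comment> \<open>Convergence also demands integrability on every bounded interval, which the
    limits \<open>pos\<close> and \<open>neg\<close> do not record; continuity of \<open>f'\<close>
    supplies it.\<close>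
  have "(\<lambda>t. f' t * exp (- s * of_real t)) integrable_on {0..R}"
    and "(\<lambda>t. f' t * exp (cnj s * of_real t)) integrable_on {-R..0}" for R
    by (intro integrable_continuous_real continuous_intros continuous_on_subset[OF assms(3)]; simp)+
  then have "sym_laplace_converges f' s"
    unfolding sym_laplace_converges_def converges_0_inf_def converges_minf_0_def
    using pos neg by blast
  moreover have "sym_laplace f' s = s * laplace f s - cnj s * laplace ?g (cnj s)"
    by (simp add: sym_laplace_def integral_0_inf_def integral_minf_0_def
        Lim_at_top_eqI[OF pos[simplified]] Lim_at_top_eqI[OF neg])
  ultimately show ?thesis
    using laplace_convergence(1)[OF assms(2,5,6)] laplace_convergence(1)[OF contg ordg s'] by blast
qed

end
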